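(* Consider the problem of minimizing $f=\sum_{i=1}^m f_i$ over $X$, and suppose that Assumption 1 (common optimal solution) and Assumption 2 (Hölder condition of order $p>0$ with moduli $L_i$) stated in the context hold. Let $\{x_k\}$ be a sequence generated by the randomized incremental subgradient method described in the context with the constant stepsize rule $v_k\equiv v\,(>0)$ for all $k\in\mathbb{N}$. Then it holds, with probability 1, that $$\liminf_{k\to\infty}f(x_k)\le f^*+\left(\frac{mv}{2R_{p,m}}\right)^p,\qquad\text{where }R_{p,m}:=L_{\max}^{-\frac1p}\min\left\{1,m^{1-\frac1p}\right\}.$$
   Context: Setting. $X\subseteq\mathbb{R}^n$ is nonempty, closed and convex, and $f_1,\dots,f_m:\mathbb{R}^n\to\mathbb{R}$ are continuous and quasi-convex (a function $h$ is quasi-convex if $h((1-\alpha)x+\alpha y)\le\max\{h(x),h(y)\}$ for all $x,y\in\mathbb{R}^n$, $\alpha\in[0,1]$). Put $f:=\sum_{i=1}^m f_i$ ($f$ need not be quasi-convex), $f^*:=\min_{x\in X}f(x)$, $X^*:=\arg\min_{x\in X}f(x)$, $f_i^*:=\min_{x\in X}f_i(x)$, $X_i^*:=\arg\min_{x\in X}f_i(x)$. $\mathbb{N}=\{0,1,2,\dots\}$; $\|\cdot\|$ is the Euclidean norm, $P_X$ the Euclidean projection onto $X$, and $S(0,1)$ the unit sphere. Assumption 1. The component functions have a common optimal solution over $X$ (equivalently $X^*=\bigcap_{i=1}^m X_i^*\neq\emptyset$). Assumption 2. $p>0$, $L_i>0$ for $i=1,\dots,m$, and for each $i$, $|f_i(y)-f_i(x)|\le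 L_i\|y-x\|^p$ for all $x\in X$ and all $y\in\mathbb{R}^n$. Put $L_{\max}:=\max_{i=1,\dots,m}L_i$. Quasi-subdifferential. For quasi-convex $h:\mathbb{R}^n\to\mathbb{R}$ and $x\in\mathbb{R}^n$, $\partial h(x):=\{g:\langle g,y-x\rangle\le 0\text{ for every } y \text{ with } h(y)<h(x)\}$. Randomized incremental subgradient method. Initialize an initial point $x_0\in\mathbb{R}^n$, a stepsize sequence $\{v_k\}$, and $k:=0$. While $f(x_k)>f^*$: let $I_k:=\{i\in\{1,\dots,m\}:f_i(x_k)>f_i^*\}$; pick equiprobably a random variable $\omega_k$ from the set $I_k$, calculate $g_{k,\omega_k}\in\partial f_{\omega_k}(x_k)\cap S(0,1)$, and set $x_{k+1}:=P_X(x_k-v_kg_{k,\omega_k})$; then $k:=k+1$. *)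

theory Defs
  imports "HOL-Probability.Probability"
begin

definition quasi_convex :: "('a::real_vector \<Rightarrow> real) \<Rightarrow> bool" where
  "quasi_convex h \<longleftrightarrow>
     (\<forall>x y. \<forall>\<alpha>\<in>{0..1}. h ((1 - \<alpha>) *\<^sub>R x + \<alpha> *\<^sub>R y) \<le> max (h x) (h y))"

(* Only meaningful if the minimum is attained; LEAST is unspecified otherwise. *)
definition min_value :: "('a \<Rightarrow> real) \<Rightarrow> 'a set \<Rightarrow> real" where
  "min_value h X = (LEAST r. r \<in> h ` X)"

definition minimizers :: "('a \<Rightarrow> real) \<Rightarrow> 'a set \<Rightarrow> 'a set" where
  "minimizers h X = {x. is_arg_min h (\<lambda>y. y \<in> X) x}"

definition quasi_subdifferential :: "('a::real_inner \<Rightarrow> real) \<Rightarrow> 'a \<Rightarrow> 'a set" where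
  "quasi_subdifferential h x = {g. \<forall>y. h y < h x \<longrightarrow> g \<bullet> (y - x) \<le> 0}"

definition total_objective :: "nat \<Rightarrow> (nat \<Rightarrow> 'a \<Rightarrow> real) \<Rightarrow> 'a \<Rightarrow> real" where
  "total_objective m f x = (\<Sum>i=1..m. f i x)"

definition active_indices :: "'a set \<Rightarrow> nat \<Rightarrow> (nat \<Rightarrow> 'a \<Rightarrow> real) \<Rightarrow> 'a \<Rightarrow> nat set" where
  "active_indices X m f x = {i \<in> {1..m}. f i x > min_value (f i) X}"

(* The sigma-algebra generated by the random vectors x 0, ..., x k. *)
definition history :: "'w measure \<Rightarrow> (nat \<Rightarrow> 'w \<Rightarrow> 'a::topological_space) \<Rightarrow> nat \<Rightarrow> 'w measure" where
  "history M x k = sigma (space M) {x j -` A \<inter> space M | j A. j \<le> k \<and> A \<in> sets borel}"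

(* Sample points are written w; \<omega> k is the index drawn in iteration k, and g k is the
   direction g_{k,\<omega>_k}.  A run that terminates is continued as a constant sequence, so that
   every sample path is infinite; the values of \<omega> k and g k after termination are irrelevant.
   The draw being equiprobable means that, conditionally on x 0, ..., x k, the index \<omega> k is
   uniformly distributed on the active indices at x k.  The direction may be selected in an
   arbitrary, not necessarily measurable way, also depending on \<omega> k and on earlier draws, as
   long as the iterates are random vectors. *)
locale randomized_incremental_subgradient = prob_space M
  for M :: "'w measure"
    and X :: "(real ^ 'n) set"
    and m :: nat
    and f :: "nat \<Rightarrow> real ^ 'n \<Rightarrow> real"
    and v :: "nat \<Rightarrow> real"
    and x0 :: "real ^ 'n"
    and x :: "nat \<Rightarrow> 'w \<Rightarrow> real ^ 'n"
    and \<omega> :: "nat \<Rightarrow> 'w \<Rightarrow> nat"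
    and g :: "nat \<Rightarrow> 'w \<Rightarrow> real ^ 'n" +
  assumes x_measurable: "\<And>k. x k \<in> borel_measurable M"
    and index_measurable: "\<And>k. \<omega> k \<in> measurable M (count_space UNIV)"
    and initial: "\<And>w. w \<in> space M \<Longrightarrow> x 0 w = x0"
    and terminated: "\<And>k w. w \<in> space M \<Longrightarrow>
          \<not> total_objective m f (x k w) > min_value (total_objective m f) X \<Longrightarrow>
          x (Suc k) w = x k w"
    and index_active: "\<And>k w. w \<in> space M \<Longrightarrow>
          total_objective m f (x k w) > min_value (total_objective m f) X \<Longrightarrow>
          \<omega> k w \<in> active_indices X m f (x k w)"
    and index_uniform: "\<And>k. AE w in M.
          total_objective m f (x k w) > min_value (total_objective m f) X \<longrightarrow>
          (\<forall>i \<in> active_indices X m f (x k w).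
             real_cond_exp M (history M x k) (indicat_real {u \<in> space M. \<omega> k u = i}) w =
               1 / real (card (active_indices X m f (x k w))))"
    and direction: "\<And>k w. w \<in> space M \<Longrightarrow>
          total_objective m f (x k w) > min_value (total_objective m f) X \<Longrightarrow>
          g k w \<in> quasi_subdifferential (f (\<omega> k w)) (x k w) \<inter> sphere 0 1"
    and step: "\<And>k w. w \<in> space M \<Longrightarrow>
          total_objective m f (x k w) > min_value (total_objective m f) X \<Longrightarrow>
          x (Suc k) w = closest_point X (x k w - v k *\<^sub>R g k w)"

end

theory Submission
  imports Defs
begin

text \<open>
  Fix a common minimizer \<open>z\<close>. The whole argument follows the squared distance
  \<open>\<parallel>x\<^sub>k - z\<parallel>\<^sup>2\<close>. If the component \<open>i\<close> is drawn at \<open>x\<^sub>k\<close>, the Hoelder condition makes \<open>f\<^sub>i\<close> smaller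
  than \<open>f\<^sub>i(x\<^sub>k)\<close> on the open ball around \<open>z\<close> of radius \<open>((f\<^sub>i(x\<^sub>k) - f\<^sub>i(z)) / L)\<^bsup>1/p\<^esup>\<close>, so the
  hyperplane through \<open>x\<^sub>k\<close> with unit normal \<open>g\<^sub>k\<close> stays at least that far from \<open>z\<close>
  (\<open>quasi_subgradient_inner_ge\<close>). A step of length \<open>v\<close> therefore decreases the squared distance by
  at least \<open>2v\<close> times this radius, up to an error \<open>v\<^sup>2\<close>; projecting onto \<open>X\<close>, a
  nonexpansive map that fixes \<open>z\<close>, does not increase it.
  Averaging the radii over the uniform draw (\<open>uniform_draw_expectation\<close>) and comparing the sum of
  \<open>(1/p)\<close>-th powers with the \<open>(1/p)\<close>-th power of the sum (\<open>sum_powr_ge\<close>, the origin of the factor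
  \<open>min {1, m\<^bsup>1 - 1/p\<^esup>}\<close>) gives a conditional drift of at most
  \<open>v\<^sup>2 - (2vR/m) (f(x\<^sub>k) - f(z))\<^bsup>1/p\<^esup>\<close>.

  This drift is negative, and bounded away from zero, as long as \<open>f(x\<^sub>k) > f(z) + d\<close> for a fixed
  \<open>d > (mv/(2R))\<^sup>p\<close>. A nonnegative integrable quantity cannot keep decreasing in mean by a fixed
  amount on an event of positive probability (\<open>AE_exit_of_drift\<close>). Hence almost surely the values
  return below \<open>f(z) + d\<close> after every time \<open>N\<close>, and letting \<open>d\<close> decrease to \<open>(mv/(2R))\<^sup>p\<close> along a
  sequence gives the bound on the lower limit.
\<close>

section \<open>Deterministic estimates\<close>

lemma min_value_eq_of_minimizer:
  assumes "z \<in> minimizers h X"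
  shows "min_value h X = h z"
proof -
  have "z \<in> X" "\<And>y. y \<in> X \<Longrightarrow> h z \<le> h y"
    using assms by (auto simp: minimizers_def is_arg_min_linorder)
  then show ?thesis
    unfolding min_value_def by (intro Least_equality) auto
qed

lemma total_objective_minimizer:
  assumes "z \<in> (\<Inter>i\<in>{1..m}. minimizers (f i) X)" "m \<ge> 1"
  shows "z \<in> minimizers (total_objective m f) X"
proof -
  have "z \<in> X"
    using assms by (auto simp: minimizers_def is_arg_min_linorder)
  moreover have "total_objective m f z \<le> total_objective m f y" if "y \<in> X" for y
    unfolding total_objective_def
    by (rule sum_mono) (use assms that in \<open>auto simp: minimizers_def is_arg_min_linorder\<close>)
  ultimately show ?thesis
    by (auto simp: minimizers_def is_arg_min_linorder)
qed

text \<open>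
  The left-hand side is a radius around \<open>z\<close> within which the Hoelder bound keeps \<open>h\<close> strictly below
  \<open>h x\<close>. For any \<open>t\<close> less than this radius, testing the quasi-subgradient inequality at \<open>z + t g\<close> gives \<open>t \<le> g \<bullet> (x - z)\<close>.
\<close>

lemma quasi_subgradient_inner_ge:
  fixes h :: "'a::real_inner \<Rightarrow> real"
  assumes hoelder: "\<And>y. h y - h z \<le> l * norm (y - z) powr p"
    and l: "l > 0" and p: "p > 0"
    and gt: "h z < h x"
    and g: "g \<in> quasi_subdifferential h x" "norm g = 1"
  shows "((h x - h z) / l) powr (1 / p) \<le> g \<bullet> (x - z)"
proof (rule dense_le_bounded[where x = 0])
  show "0 < ((h x - h z) / l) powr (1 / p)"
    using gt l by simp
next
  fix t assume t: "0 < t" "t < ((h x - h z) / l) powr (1 / p)"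
  have "t powr p < (((h x - h z) / l) powr (1 / p)) powr p"
    using t p by (intro powr_less_mono2) auto
  also have "\<dots> = (h x - h z) / l"
    using gt l p by (simp add: powr_powr)
  finally have "l * t powr p < h x - h z"
    using l by (simp add: field_simps)
  moreover have "h (z + t *\<^sub>R g) - h z \<le> l * t powr p"
    using hoelder[of "z + t *\<^sub>R g"] g(2) t by simp
  ultimately have "h (z + t *\<^sub>R g) < h x"
    by linarith
  then have "g \<bullet> (z + t *\<^sub>R g - x) \<le> 0"
    using g(1) by (auto simp: quasi_subdifferential_def)
  moreover have "g \<bullet> g = 1"
    using g(2) by (simp add: dot_square_norm)
  ultimately show "t \<le> g \<bullet> (x - z)"
    by (simp add: inner_diff_right inner_add_right)
qed

lemma norm_projected_step_le:
  fixes z :: "'a::euclidean_space"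
  assumes "closed X" "convex X" "z \<in> X"
  shows "norm (closest_point X y - z) \<le> norm (y - z)"
proof -
  have "dist (closest_point X y) (closest_point X z) \<le> dist y z"
    using assms by (intro closest_point_lipschitz) auto
  then show ?thesis
    using assms(3) by (simp add: closest_point_self dist_norm)
qed

lemma norm_unit_step_power2:
  fixes x z g :: "'a::real_inner"
  assumes "norm g = 1"
  shows "(norm (x - t *\<^sub>R g - z))\<^sup>2 = (norm (x - z))\<^sup>2 - 2 * t * (g \<bullet> (x - z)) + t\<^sup>2"
proof -
  have "g \<bullet> g = 1"
    using assms by (simp add: dot_square_norm)
  then show ?thesis
    unfolding power2_norm_eq_inner
    by (simp add: inner_diff_left inner_diff_right inner_commute algebra_simps power2_eq_square)
qed

text \<open>
  For \<open>q \<le> 1\<close> normalize so that the \<open>a i\<close> sum to 1: each is then at most its \<open>q\<close>-th power. For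
  \<open>q > 1\<close> this is Jensen's inequality for the convex \<open>q\<close>-th power, which yields the constant
  \<open>card I\<close> to the power \<open>1 - q\<close>. Passing to an upper bound \<open>m\<close> makes the constant independent of \<open>I\<close>.
\<close>

lemma sum_powr_ge:
  fixes a :: "'i \<Rightarrow> real"
  assumes I: "finite I" "I \<noteq> {}" "card I \<le> m"
    and a: "\<And>i. i \<in> I \<Longrightarrow> a i > 0"
    and q: "q > 0"
  shows "min 1 (real m powr (1 - q)) * (\<Sum>i\<in>I. a i) powr q \<le> (\<Sum>i\<in>I. a i powr q)"
proof -
  define S where "S = (\<Sum>i\<in>I. a i)"
  have S: "S > 0"
    unfolding S_def using I a by (intro sum_pos) auto
  have n: "real (card I) > 0"
    using I by (simp add: card_gt_0_iff)
  show ?thesis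
  proof (cases "q \<le> 1")
    case True
    have "S powr q = (\<Sum>i\<in>I. a i / S) * S powr q"
      using S by (simp add: S_def flip: sum_divide_distrib)
    also have "\<dots> \<le> (\<Sum>i\<in>I. (a i / S) powr q) * S powr q"
    proof (intro mult_right_mono sum_mono)
      fix i assume i: "i \<in> I"
      then have "a i \<le> S"
        unfolding S_def using I a by (intro member_le_sum) (auto intro: less_imp_le)
      then have "(a i / S) powr 1 \<le> (a i / S) powr q"
        using True S a[OF i] by (intro powr_mono') auto
      then show "a i / S \<le> (a i / S) powr q"
        using S a[OF i] by simp
    qed simp
    also have "\<dots> = (\<Sum>i\<in>I. a i powr q)"
      unfolding sum_distrib_right using S a
      by (intro sum.cong refl) (simp add: powr_divide less_imp_le)
    finally have "S powr q \<le> (\<Sum>i\<in>I. a i powr q)" .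
    moreover have "min 1 (real m powr (1 - q)) * S powr q \<le> 1 * S powr q"
      by (intro mult_right_mono) auto
    ultimately show ?thesis
      unfolding S_def by linarith
  next
    case False
    have "(\<Sum>i\<in>I. (1 / card I) *\<^sub>R a i) powr q \<le> (\<Sum>i\<in>I. (1 / card I) * (a i powr q))"
      using I a n False by (intro convex_on_sum[OF _ _ powr_convex]) auto
    then have "(S / card I) powr q \<le> (\<Sum>i\<in>I. a i powr q) / card I"
      unfolding S_def by (simp flip: sum_divide_distrib)
    then have "card I * (S powr q / card I powr q) \<le> (\<Sum>i\<in>I. a i powr q)"
      using S n by (simp add: powr_divide field_simps)
    moreover have "card I * (S powr q / card I powr q) = real (card I) powr (1 - q) * S powr q"
      using n by (simp add: powr_diff)
    moreover have "real m powr (1 - q) \<le> real (card I) powr (1 - q)"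
      using I n False by (intro powr_mono2') auto
    then have "min 1 (real m powr (1 - q)) * S powr q \<le> real (card I) powr (1 - q) * S powr q"
      by (intro mult_right_mono) auto
    ultimately show ?thesis
      unfolding S_def by linarith
  qed
qed

section \<open>Negative drift forces exit\<close>

text \<open>
  If the events \<open>A k\<close> had an intersection of measure \<open>\<mu> > 0\<close>, then the integral of \<open>V k\<close> over
  \<open>A k\<close> would drop by at least \<open>\<epsilon> \<mu>\<close> in every step and eventually become negative; shrinking
  the domain from \<open>A k\<close> to \<open>A (Suc k)\<close> only helps because \<open>V\<close> is nonnegative.
\<close>

lemma (in finite_measure) AE_exit_of_drift:
  fixes V :: "nat \<Rightarrow> 'a \<Rightarrow> real" and A :: "nat \<Rightarrow> 'a set"
  assumes A: "\<And>k. A k \<in> sets M" "decseq A"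
    and V: "\<And>k. integrable M (V k)" "\<And>k w. 0 \<le> V k w"
    and \<epsilon>: "\<epsilon> > 0"
    and drift: "\<And>k. (\<integral>w. indicator (A k) w * V (Suc k) w \<partial>M)
                 \<le> (\<integral>w. indicator (A k) w * V k w \<partial>M) - \<epsilon> * measure M (A k)"
  shows "AE w in M. \<exists>k. w \<notin> A k"
proof -
  define E where "E k = (\<integral>w. indicator (A k) w * V k w \<partial>M)" for k
  define \<mu> where "\<mu> = measure M (\<Inter>k. A k)"
  have int: "integrable M (\<lambda>w. indicator (A j) w * V k w)" for j k
    using integrable_mult_indicator[OF A(1) V(1)] by simp
  have Inter: "(\<Inter>k. A k) \<in> sets M"
    using A(1) by (intro sets.countable_INT) auto
  have "E k \<le> E 0 - k * (\<epsilon> * \<mu>)" for k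
  proof (induction k)
    case (Suc k)
    have "\<epsilon> * \<mu> \<le> \<epsilon> * measure M (A k)"
      unfolding \<mu>_def using \<epsilon> A(1)
      by (intro mult_left_mono finite_measure_mono) auto
    moreover have "A (Suc k) \<subseteq> A k"
      using A(2) by (simp add: decseq_Suc_iff)
    then have "E (Suc k) \<le> (\<integral>w. indicator (A k) w * V (Suc k) w \<partial>M)"
      unfolding E_def using V(2)
      by (intro integral_mono[OF int int]) (auto simp: indicator_def)
    moreover note drift[of k] Suc
    ultimately have "E (Suc k) \<le> E 0 - k * (\<epsilon> * \<mu>) - \<epsilon> * \<mu>"
      unfolding E_def by linarith
    then show ?case
      by (simp add: algebra_simps)
  qed simp
  moreover have "0 \<le> E k" for k
    unfolding E_def using V(2) by (intro integral_nonneg_AE) auto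
  ultimately have bound: "real k * (\<epsilon> * \<mu>) \<le> E 0" for k
    by (metis diff_ge_0_iff_ge order_trans)
  have "\<mu> = 0"
  proof (rule ccontr)
    assume "\<mu> \<noteq> 0"
    then have "\<epsilon> * \<mu> > 0"
      using \<epsilon> by (simp add: \<mu>_def less_le)
    then obtain n where "E 0 < real n * (\<epsilon> * \<mu>)"
      using reals_Archimedean3 by blast
    with bound show False
      by (meson not_le)
  qed
  then have "(\<Inter>k. A k) \<in> null_sets M"
    using Inter by (simp add: \<mu>_def null_sets_def emeasure_eq_measure)
  then show ?thesis
    by (rule AE_I') auto
qed

section \<open>Averaging over the uniform draw\<close>

context randomized_incremental_subgradient
begin

lemma subalgebra_history: "subalgebra M (history M x k)"
proof -
  have "{x j -` A \<inter> space M | j A. j \<le> k \<and> A \<in> sets borel} \<subseteq> sets M"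
    using x_measurable measurable_sets by blast
  then show ?thesis
    unfolding subalgebra_def history_def
    by (simp add: sets.sigma_sets_subset space_measure_of_conv sets_measure_of_conv)
qed

lemma measurable_history: "j \<le> k \<Longrightarrow> x j \<in> measurable (history M x k) borel"
  unfolding history_def
  by (rule measurableI) (auto simp: space_measure_of_conv intro!: in_measure_of)


text \<open>
  On an event of the past at which the run has not stopped, the drawn index may be replaced by the
  average over the active indices. Split the left-hand integrand by the value of \<open>\<omega> k\<close>: each part
  is a function of the past times the indicator of \<open>\<omega> k = i\<close>, and integrating it replaces that
  indicator by its conditional expectation, the reciprocal of the number of active indices.
\<close>

lemma uniform_draw_expectation:
  assumes f: "\<And>i. i \<in> {1..m} \<Longrightarrow> f i \<in> borel_measurable borel"
    and \<phi>: "\<And>i. i \<in> {1..m} \<Longrightarrow> \<phi> i \<in> borel_measurable borel"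
    and bound: "\<And>i w. w \<in> space M \<Longrightarrow> i \<in> active_indices X m f (x k w) \<Longrightarrow> \<bar>\<phi> i (x k w)\<bar> \<le> B"
    and A: "A \<in> sets (history M x k)"
    and running: "\<And>w. w \<in> A \<Longrightarrow>
          total_objective m f (x k w) > min_value (total_objective m f) X"
  shows "integrable M (\<lambda>w. indicator A w * \<phi> (\<omega> k w) (x k w))" (is ?int)
    and "integrable M (\<lambda>w. indicator A w *
            ((\<Sum>i\<in>active_indices X m f (x k w). \<phi> i (x k w)) / card (active_indices X m f (x k w))))"
      (is ?int')
    and "(\<integral>w. indicator A w * \<phi> (\<omega> k w) (x k w) \<partial>M) =
         (\<integral>w. indicator A w *
            ((\<Sum>i\<in>active_indices X m f (x k w). \<phi> i (x k w)) / card (active_indices X m f (x k w))) \<partial>M)"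
      (is ?eq)
proof -
  let ?F = "history M x k"
  let ?a = "\<lambda>w. active_indices X m f (x k w)"
  interpret finite_measure_subalgebra M ?F
    by unfold_locales (rule subalgebra_history)
  have AM: "A \<in> sets M"
    using A subalgebra_history by (auto simp: subalgebra_def)
  then have A_space: "A \<subseteq> space M"
    by (rule sets.sets_into_space)
  define G where "G i w = indicator A w * (indicator {y. f i y > min_value (f i) X} (x k w) * \<phi> i (x k w))"
    for i w
  \<comment> \<open>\<open>G i\<close> depends on the past only; the factor for activity of \<open>i\<close> is what allows the
    conditional probability to be evaluated and the bound on \<open>\<phi>\<close> to be applied.\<close>
  define J where "J i = (indicat_real {u \<in> space M. \<omega> k u = i})" for i
  have G_active: "G i w = (if w \<in> A \<and> i \<in> ?a w then \<phi> i (x k w) else 0)" if "i \<in> {1..m}" for i w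
    using that by (auto simp: G_def active_indices_def)
  have level: "{y. f i y > min_value (f i) X} \<in> sets borel" if "i \<in> {1..m}" for i
    using borel_measurable_less[OF borel_measurable_const f[OF that]] by simp
  have G_meas: "G i \<in> borel_measurable ?F" if "i \<in> {1..m}" for i
  proof -
    note [measurable] = measurable_history[of k k] f[OF that] \<phi>[OF that] A level[OF that]
    show ?thesis
      unfolding G_def by measurable
  qed
  have J_meas [measurable]: "J i \<in> borel_measurable M" for i
  proof -
    note [measurable] = index_measurable[of k]
    show ?thesis
      unfolding J_def by measurable
  qed
  have GJ_int: "integrable M (\<lambda>w. G i w * J i w)" if i: "i \<in> {1..m}" for i
  proof (rule integrable_const_bound[where B = "max B 0"])
    show "AE w in M. norm (G i w * J i w) \<le> max B 0"
      using A_space bound[of _ i] by (auto simp: G_active[OF i] J_def indicator_def le_max_iff_disj)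
    show "(\<lambda>w. G i w * J i w) \<in> borel_measurable M"
      using measurable_from_subalg[OF subalgebra_history G_meas[OF i]] by measurable
  qed
  note cond = real_cond_exp_intg[OF GJ_int G_meas J_meas]
  have drawn: "indicator A w * \<phi> (\<omega> k w) (x k w) = (\<Sum>i=1..m. G i w * J i w)"
    if w: "w \<in> space M" for w
  proof (cases "w \<in> A")
    case True
    then have \<omega>: "\<omega> k w \<in> ?a w" "\<omega> k w \<in> {1..m}"
      using index_active[OF w running] by (auto simp: active_indices_def)
    have "(\<Sum>i=1..m. G i w * J i w) = (\<Sum>i=1..m. if \<omega> k w = i then \<phi> i (x k w) else 0)"
      using True w \<omega> by (intro sum.cong refl) (auto simp: G_active J_def)
    then show ?thesis
      using True \<omega> by simp
  qed (simp add: G_def)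
  have averaged: "AE w in M. (\<Sum>i=1..m. G i w * real_cond_exp M ?F (J i) w) =
      indicator A w * ((\<Sum>i\<in>?a w. \<phi> i (x k w)) / card (?a w))"
    using index_uniform[of k] AE_space
  proof eventually_elim
    fix w
    assume unif: "total_objective m f (x k w) > min_value (total_objective m f) X \<longrightarrow>
        (\<forall>i\<in>?a w. real_cond_exp M ?F (indicat_real {u \<in> space M. \<omega> k u = i}) w =
               1 / real (card (?a w)))"
    show "(\<Sum>i=1..m. G i w * real_cond_exp M ?F (J i) w) =
      indicator A w * ((\<Sum>i\<in>?a w. \<phi> i (x k w)) / card (?a w))"
    proof (cases "w \<in> A")
      case True
      have "(\<Sum>i=1..m. G i w * real_cond_exp M ?F (J i) w)
          = (\<Sum>i=1..m. if i \<in> ?a w then \<phi> i (x k w) / card (?a w) else 0)"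
        using True unif running[OF True] by (intro sum.cong refl) (auto simp: G_active J_def)
      also have "\<dots> = (\<Sum>i\<in>{1..m} \<inter> ?a w. \<phi> i (x k w) / card (?a w))"
        by (simp add: sum.inter_restrict)
      also have "{1..m} \<inter> ?a w = ?a w"
        by (auto simp: active_indices_def)
      finally show ?thesis
        using True by (simp add: sum_divide_distrib)
    qed (simp add: G_def)
  qed
  \<comment> \<open>Written with indicators of level sets, both the sum over the random index set and its
    cardinality are visibly measurable.\<close>
  have target_meas: "(\<lambda>w. indicator A w * ((\<Sum>i\<in>?a w. \<phi> i (x k w)) / card (?a w))) \<in> borel_measurable M"
  proof -
    have "real (card (?a w)) = (\<Sum>i=1..m. indicator {y. f i y > min_value (f i) X} (x k w))" for w
      by (simp add: active_indices_def indicator_def sum.If_cases Int_def)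
    moreover have "indicator A w * (\<Sum>i\<in>?a w. \<phi> i (x k w)) = (\<Sum>i=1..m. G i w)" for w
    proof -
      have "{1..m} \<inter> ?a w = ?a w"
        by (auto simp: active_indices_def)
      then have "(\<Sum>i\<in>?a w. \<phi> i (x k w)) = (\<Sum>i=1..m. if i \<in> ?a w then \<phi> i (x k w) else 0)"
        using sum.inter_restrict[of "{1..m}" "\<lambda>i. \<phi> i (x k w)" "?a w"] by simp
      then show ?thesis
        by (auto simp: sum_distrib_left G_active indicator_def intro!: sum.cong sum.neutral[symmetric])
    qed
    ultimately have eq: "(\<lambda>w. indicator A w * ((\<Sum>i\<in>?a w. \<phi> i (x k w)) / card (?a w))) =
        (\<lambda>w. (\<Sum>i=1..m. G i w) / (\<Sum>i=1..m. indicator {y. f i y > min_value (f i) X} (x k w)))"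
      by (simp only: times_divide_eq_right)
    have "(\<lambda>w. indicat_real {y. f i y > min_value (f i) X} (x k w)) \<in> borel_measurable M" if "i \<in> {1..m}" for i
      using measurable_compose[OF x_measurable borel_measurable_indicator[OF level[OF that]]] .
    then show ?thesis
      unfolding eq using measurable_from_subalg[OF subalgebra_history G_meas]
      by (intro borel_measurable_divide borel_measurable_sum)
  qed
  have sum_int: "integrable M (\<lambda>w. \<Sum>i=1..m. G i w * J i w)"
    "integrable M (\<lambda>w. \<Sum>i=1..m. G i w * real_cond_exp M ?F (J i) w)"
    using GJ_int cond(1) by (auto intro!: Bochner_Integration.integrable_sum)
  show ?int
    using sum_int(1) by (subst Bochner_Integration.integrable_cong[OF refl drawn])
  show ?int'
    using sum_int(2) averaged target_meas
    by (subst integrable_cong_AE[where g = "\<lambda>w. \<Sum>i=1..m. G i w * real_cond_exp M ?F (J i) w"]) auto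
  have "(\<integral>w. indicator A w * \<phi> (\<omega> k w) (x k w) \<partial>M) = (\<integral>w. (\<Sum>i=1..m. G i w * J i w) \<partial>M)"
    by (rule Bochner_Integration.integral_cong[OF refl drawn])
  also have "\<dots> = (\<Sum>i=1..m. \<integral>w. G i w * J i w \<partial>M)"
    using GJ_int by (intro Bochner_Integration.integral_sum) auto
  also have "\<dots> = (\<Sum>i=1..m. \<integral>w. G i w * real_cond_exp M ?F (J i) w \<partial>M)"
    using cond(2) by simp
  also have "\<dots> = (\<integral>w. (\<Sum>i=1..m. G i w * real_cond_exp M ?F (J i) w) \<partial>M)"
    using cond(1) by (intro Bochner_Integration.integral_sum[symmetric]) auto
  also have "\<dots> = (\<integral>w. indicator A w * ((\<Sum>i\<in>?a w. \<phi> i (x k w)) / card (?a w)) \<partial>M)"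
    using averaged target_meas sum_int(2) by (intro integral_cong_AE) auto
  finally show ?eq .
qed

end

section \<open>Expected decrease of the distance to a common minimizer\<close>

text \<open>
  The reference point \<open>z\<close>, to which all distances are measured, is a common minimizer; the Hoelder
  condition is anchored there, with one modulus \<open>l\<close> for all components.
\<close>

locale hoelder_incremental_subgradient =
  randomized_incremental_subgradient M X m f v x0 x \<omega> g
  for M :: "'w measure"
    and X :: "(real ^ 'n) set"
    and m :: nat
    and f :: "nat \<Rightarrow> real ^ 'n \<Rightarrow> real"
    and v :: "nat \<Rightarrow> real"
    and x0 :: "real ^ 'n"
    and x :: "nat \<Rightarrow> 'w \<Rightarrow> real ^ 'n"
    and \<omega> :: "nat \<Rightarrow> 'w \<Rightarrow> nat"
    and g :: "nat \<Rightarrow> 'w \<Rightarrow> real ^ 'n" +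
  fixes z :: "real ^ 'n" and l p :: real
  assumes X_closed: "closed X" and X_convex: "convex X"
    and m_ge_1: "m \<ge> 1"
    and f_measurable: "\<And>i. i \<in> {1..m} \<Longrightarrow> f i \<in> borel_measurable borel"
    and z_common: "z \<in> (\<Inter>i\<in>{1..m}. minimizers (f i) X)"
    and hoelder_at_z: "\<And>i y. i \<in> {1..m} \<Longrightarrow> f i y - f i z \<le> l * norm (y - z) powr p"
    and l_pos: "l > 0" and p_pos: "p > 0"
    and step_pos: "\<And>k. v k > 0"
begin

lemma z_in_X: "z \<in> X"
  using z_common m_ge_1 by (auto simp: minimizers_def is_arg_min_linorder)

lemma min_value_component: "i \<in> {1..m} \<Longrightarrow> min_value (f i) X = f i z"
  using z_common by (auto intro: min_value_eq_of_minimizer)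

lemma min_value_total: "min_value (total_objective m f) X = total_objective m f z"
  using total_objective_minimizer[OF z_common m_ge_1] by (rule min_value_eq_of_minimizer)

abbreviation running :: "nat \<Rightarrow> 'w \<Rightarrow> bool" where
  "running k w \<equiv> total_objective m f (x k w) > min_value (total_objective m f) X"

text \<open>
  The radius of a ball around \<open>z\<close> on which the Hoelder condition keeps \<open>f i\<close> below \<open>f i y\<close>. It is
  used for \<open>i\<close> active at \<open>y\<close>, where the base of the power is positive.
\<close>

definition gap_distance :: "nat \<Rightarrow> real ^ 'n \<Rightarrow> real" where
  "gap_distance i y = ((f i y - f i z) / l) powr (1 / p)"

lemma gap_distance_le:
  assumes "i \<in> active_indices X m f y"
  shows "gap_distance i y \<le> norm (y - z)"
proof -
  have i: "i \<in> {1..m}" and gt: "f i y > f i z"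
    using assms min_value_component by (auto simp: active_indices_def)
  have "(f i y - f i z) / l \<le> norm (y - z) powr p"
    using hoelder_at_z[OF i, of y] l_pos by (simp add: field_simps)
  then have "gap_distance i y \<le> (norm (y - z) powr p) powr (1 / p)"
    unfolding gap_distance_def using gt l_pos p_pos by (intro powr_mono2) auto
  then show ?thesis
    using p_pos by (simp add: powr_powr)
qed

lemma sq_dist_step:
  assumes w: "w \<in> space M" and run: "running k w"
  shows "(norm (x (Suc k) w - z))\<^sup>2
          \<le> (norm (x k w - z))\<^sup>2 - 2 * v k * gap_distance (\<omega> k w) (x k w) + (v k)\<^sup>2"
proof -
  have i: "\<omega> k w \<in> {1..m}" and gt: "f (\<omega> k w) (x k w) > f (\<omega> k w) z"
    using index_active[OF w run] min_value_component by (auto simp: active_indices_def)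
  have g: "g k w \<in> quasi_subdifferential (f (\<omega> k w)) (x k w)" "norm (g k w) = 1"
    using direction[OF w run] by auto
  have "gap_distance (\<omega> k w) (x k w) \<le> g k w \<bullet> (x k w - z)"
    unfolding gap_distance_def
    by (rule quasi_subgradient_inner_ge[OF hoelder_at_z[OF i] l_pos p_pos gt g])
  then have "2 * v k * gap_distance (\<omega> k w) (x k w) \<le> 2 * v k * (g k w \<bullet> (x k w - z))"
    using step_pos[of k] by (intro mult_left_mono) auto
  moreover have "norm (x (Suc k) w - z) \<le> norm (x k w - v k *\<^sub>R g k w - z)"
    unfolding step[OF w run] by (rule norm_projected_step_le[OF X_closed X_convex z_in_X])
  then have "(norm (x (Suc k) w - z))\<^sup>2 \<le> (norm (x k w - v k *\<^sub>R g k w - z))\<^sup>2"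
    by (intro power_mono) auto
  ultimately show ?thesis
    unfolding norm_unit_step_power2[OF g(2)] by linarith
qed

text \<open>
  The crude bound, valid on every sample path, serves to make all expectations finite.
\<close>

lemma sq_dist_bound:
  assumes w: "w \<in> space M"
  shows "(norm (x k w - z))\<^sup>2 \<le> (norm (x0 - z))\<^sup>2 + (\<Sum>j<k. (v j)\<^sup>2)"
proof (induction k)
  case 0
  show ?case
    using initial[OF w] by simp
next
  case (Suc k)
  have "(norm (x (Suc k) w - z))\<^sup>2 \<le> (norm (x k w - z))\<^sup>2 + (v k)\<^sup>2"
  proof (cases "running k w")
    case True
    have "0 \<le> 2 * v k * gap_distance (\<omega> k w) (x k w)"
      using step_pos[of k] by (simp add: gap_distance_def)
    with sq_dist_step[OF w True] show ?thesis
      by linarith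
  qed (simp add: terminated[OF w])
  with Suc show ?case
    by simp
qed

lemma integrable_sq_dist: "integrable M (\<lambda>w. (norm (x k w - z))\<^sup>2)"
proof (rule integrable_const_bound)
  show "AE w in M. norm ((norm (x k w - z))\<^sup>2) \<le> (norm (x0 - z))\<^sup>2 + (\<Sum>j<k. (v j)\<^sup>2)"
    using sq_dist_bound by (intro AE_I2) simp
  show "(\<lambda>w. (norm (x k w - z))\<^sup>2) \<in> borel_measurable M"
    using x_measurable[of k] by measurable
qed

definition rate :: real where
  "rate = l powr (- 1 / p) * min 1 (real m powr (1 - 1 / p))"

lemma rate_pos: "rate > 0"
  using l_pos m_ge_1 by (simp add: rate_def)

text \<open>
  Dropping the inactive components can only increase the total gap, even at a point outside \<open>X\<close>,
  where such a component may lie strictly below its minimum over \<open>X\<close>.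
\<close>

lemma average_gap_distance_ge:
  assumes "total_objective m f y > total_objective m f z"
  shows "rate / m * (total_objective m f y - total_objective m f z) powr (1 / p)
          \<le> (\<Sum>i\<in>active_indices X m f y. gap_distance i y) / card (active_indices X m f y)"
proof -
  let ?I = "active_indices X m f y"
  let ?d = "total_objective m f y - total_objective m f z"
  have I_sub: "?I \<subseteq> {1..m}"
    by (auto simp: active_indices_def)
  then have fin: "finite ?I" and card: "card ?I \<le> m"
    using finite_subset card_mono[of "{1..m}" ?I] by auto
  have pos: "f i y - f i z > 0" if "i \<in> ?I" for i
    using that min_value_component by (auto simp: active_indices_def)
  have "?d = (\<Sum>i=1..m. f i y - f i z)"
    by (simp add: total_objective_def sum_subtractf)
  also have "\<dots> = (\<Sum>i\<in>?I. f i y - f i z) + (\<Sum>i\<in>{1..m} - ?I. f i y - f i z)"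
    using sum.subset_diff[OF I_sub, of "\<lambda>i. f i y - f i z"] by simp
  also have "(\<Sum>i\<in>{1..m} - ?I. f i y - f i z) \<le> 0"
    using min_value_component by (intro sum_nonpos) (auto simp: active_indices_def)
  finally have d_le: "?d \<le> (\<Sum>i\<in>?I. f i y - f i z)"
    by simp
  have ne: "?I \<noteq> {}"
  proof
    assume "?I = {}"
    with d_le assms show False
      by simp
  qed
  have "rate * ?d powr (1 / p)
      \<le> l powr (- 1 / p) * (min 1 (real m powr (1 - 1 / p)) * (\<Sum>i\<in>?I. f i y - f i z) powr (1 / p))"
    unfolding rate_def mult.assoc using d_le assms p_pos
    by (intro mult_left_mono powr_mono2) auto
  also have "\<dots> \<le> l powr (- 1 / p) * (\<Sum>i\<in>?I. (f i y - f i z) powr (1 / p))"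
    using pos p_pos by (intro mult_left_mono sum_powr_ge[OF fin ne card]) auto
  also have "\<dots> = (\<Sum>i\<in>?I. gap_distance i y)"
    unfolding sum_distrib_left gap_distance_def using pos l_pos
    by (intro sum.cong refl) (simp add: powr_divide less_imp_le powr_minus_divide)
  finally have "rate * ?d powr (1 / p) / m \<le> (\<Sum>i\<in>?I. gap_distance i y) / m"
    by (intro divide_right_mono) auto
  also have "\<dots> \<le> (\<Sum>i\<in>?I. gap_distance i y) / card ?I"
  proof (intro divide_left_mono sum_nonneg mult_pos_pos)
    show "real (card ?I) > 0"
      using ne fin by (simp add: card_gt_0_iff)
  qed (use card m_ge_1 in \<open>auto simp: gap_distance_def\<close>)
  finally show ?thesis
    by simp
qed

lemma expected_sq_dist_step:
  assumes A: "A \<in> sets (history M x k)"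
    and d: "d \<ge> 0"
    and above: "\<And>w. w \<in> A \<Longrightarrow> total_objective m f (x k w) > total_objective m f z + d"
  shows "(\<integral>w. indicator A w * (norm (x (Suc k) w - z))\<^sup>2 \<partial>M)
          \<le> (\<integral>w. indicator A w * (norm (x k w - z))\<^sup>2 \<partial>M)
            - (2 * v k * rate / m * d powr (1 / p) - (v k)\<^sup>2) * measure M A"
proof -
  let ?avg = "\<lambda>w. (\<Sum>i\<in>active_indices X m f (x k w). gap_distance i (x k w)) /
                    card (active_indices X m f (x k w))"
  let ?D = "rate / m * d powr (1 / p)"
  have AM: "A \<in> sets M"
    using A subalgebra_history by (auto simp: subalgebra_def)
  then have A_space: "A \<subseteq> space M"
    by (rule sets.sets_into_space)
  have run: "running k w" if "w \<in> A" for w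
    using above[OF that] d min_value_total by simp
  have gap_meas: "gap_distance i \<in> borel_measurable borel" if "i \<in> {1..m}" for i
  proof -
    note [measurable] = f_measurable[OF that]
    show ?thesis
      unfolding gap_distance_def by measurable
  qed
  have gap_bound: "\<bar>gap_distance i (x k w)\<bar> \<le> sqrt ((norm (x0 - z))\<^sup>2 + (\<Sum>j<k. (v j)\<^sup>2))"
    if "w \<in> space M" "i \<in> active_indices X m f (x k w)" for i w
  proof -
    have "\<bar>gap_distance i (x k w)\<bar> \<le> norm (x k w - z)"
      using gap_distance_le[OF that(2)] by (simp add: gap_distance_def)
    also have "\<dots> \<le> sqrt ((norm (x0 - z))\<^sup>2 + (\<Sum>j<k. (v j)\<^sup>2))"
      by (rule real_le_rsqrt[OF sq_dist_bound[OF that(1)]])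
    finally show ?thesis .
  qed
  note draw = uniform_draw_expectation[where \<phi> = gap_distance, OF f_measurable gap_meas gap_bound A run]
  have sq_int: "integrable M (\<lambda>w. indicator A w * (norm (x j w - z))\<^sup>2)" for j
    using integrable_mult_indicator[OF AM integrable_sq_dist] by simp
  have A_int: "integrable M (\<lambda>w. indicator A w * c)" for c :: real
    using AM by (simp add: integrable_mult_left emeasure_eq_measure)
  have gap_int: "integrable M (\<lambda>w. 2 * v k * (indicator A w * gap_distance (\<omega> k w) (x k w)))"
    by (rule integrable_mult_right[OF draw(1)])
  have A_val: "(\<integral>w. indicator A w * c \<partial>M) = measure M A * c" for c :: real
    using AM A_space by (simp add: Int_absorb2)
  have "(\<integral>w. indicator A w * (norm (x (Suc k) w - z))\<^sup>2 \<partial>M)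
      \<le> (\<integral>w. indicator A w * (norm (x k w - z))\<^sup>2
            - 2 * v k * (indicator A w * gap_distance (\<omega> k w) (x k w)) + indicator A w * (v k)\<^sup>2 \<partial>M)"
  proof (rule integral_mono)
    fix w assume w: "w \<in> space M"
    show "indicator A w * (norm (x (Suc k) w - z))\<^sup>2
        \<le> indicator A w * (norm (x k w - z))\<^sup>2
            - 2 * v k * (indicator A w * gap_distance (\<omega> k w) (x k w)) + indicator A w * (v k)\<^sup>2"
      using sq_dist_step[OF w run] by (cases "w \<in> A") auto
  qed (intro sq_int A_int gap_int Bochner_Integration.integrable_add Bochner_Integration.integrable_diff)+
  also have "\<dots> = (\<integral>w. indicator A w * (norm (x k w - z))\<^sup>2 \<partial>M)
            - 2 * v k * (\<integral>w. indicator A w * gap_distance (\<omega> k w) (x k w) \<partial>M)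
            + measure M A * (v k)\<^sup>2"
    by (simp only: Bochner_Integration.integral_add[OF Bochner_Integration.integrable_diff[OF sq_int gap_int] A_int]
        Bochner_Integration.integral_diff[OF sq_int gap_int] integral_mult_right_zero A_val)
  also have "(\<integral>w. indicator A w * gap_distance (\<omega> k w) (x k w) \<partial>M) = (\<integral>w. indicator A w * ?avg w \<partial>M)"
    by (rule draw(3))
  finally have upper: "(\<integral>w. indicator A w * (norm (x (Suc k) w - z))\<^sup>2 \<partial>M)
      \<le> (\<integral>w. indicator A w * (norm (x k w - z))\<^sup>2 \<partial>M)
            - 2 * v k * (\<integral>w. indicator A w * ?avg w \<partial>M) + measure M A * (v k)\<^sup>2" .
  have "measure M A * ?D = (\<integral>w. indicator A w * ?D \<partial>M)"
    by (simp only: A_val)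
  also have "\<dots> \<le> (\<integral>w. indicator A w * ?avg w \<partial>M)"
  proof (rule integral_mono[OF A_int draw(2)])
    fix w assume w: "w \<in> space M"
    show "indicator A w * ?D \<le> indicator A w * ?avg w"
    proof (cases "w \<in> A")
      case True
      have "?D \<le> rate / m * (total_objective m f (x k w) - total_objective m f z) powr (1 / p)"
        using above[OF True] d p_pos rate_pos by (intro mult_left_mono powr_mono2) auto
      also have "\<dots> \<le> ?avg w"
        using above[OF True] d by (intro average_gap_distance_ge) auto
      finally show ?thesis
        using True by simp
    qed simp
  qed
  finally have "2 * v k * (measure M A * ?D) \<le> 2 * v k * (\<integral>w. indicator A w * ?avg w \<partial>M)"
    using step_pos[of k] by (intro mult_left_mono) auto
  with upper show ?thesis
    by (simp add: algebra_simps)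
qed

section \<open>Constant stepsize\<close>

text \<open>
  The threshold on \<open>d\<close> is exactly where the drift \<open>2 s rate / m * d\<^bsup>1/p\<^esup> - s\<^sup>2\<close> changes sign.
\<close>

lemma AE_returns_below:
  assumes v: "\<And>k. v k = s"
    and d: "d > (real m * s / (2 * rate)) powr p"
  shows "AE w in M. \<exists>k\<ge>N. total_objective m f (x k w) \<le> total_objective m f z + d"
proof -
  let ?c = "total_objective m f z + d"
  define A where "A k = {w \<in> space M. \<forall>j\<in>{N..N + k}. total_objective m f (x j w) > ?c}" for k
  have s: "s > 0"
    using step_pos[of 0] v by simp
  have d_pos: "d > 0"
    using d powr_ge_zero by (rule order.strict_trans1[rotated])
  have "real m * s / (2 * rate) < d powr (1 / p)"
  proof -
    have "((real m * s / (2 * rate)) powr p) powr (1 / p) < d powr (1 / p)"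
      using d p_pos by (intro powr_less_mono2) auto
    then show ?thesis
      using p_pos rate_pos s by (simp add: powr_powr)
  qed
  then have "s * (s * m) < s * (2 * rate * d powr (1 / p))"
    using rate_pos s by (simp add: field_simps)
  then have drift_pos: "2 * s * rate / m * d powr (1 / p) - s\<^sup>2 > 0"
    using m_ge_1 by (simp add: field_simps power2_eq_square)
  have total_meas: "total_objective m f \<in> borel_measurable borel"
    unfolding total_objective_def[abs_def] using f_measurable by (intro borel_measurable_sum)
  have A_hist: "A k \<in> sets (history M x (N + k))" for k
  proof -
    have "{w \<in> space (history M x (N + k)). total_objective m f (x j w) > ?c} \<in> sets (history M x (N + k))"
      if "j \<in> {N..N + k}" for j
    proof -
      have "j \<le> N + k"
        using that by simp
      note [measurable] = total_meas measurable_history[OF this]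
      show ?thesis
        by measurable
    qed
    then have "{w \<in> space (history M x (N + k)). \<forall>j\<in>{N..N + k}. total_objective m f (x j w) > ?c}
        \<in> sets (history M x (N + k))"
      by (intro sets.sets_Collect_finite_All') auto
    then show ?thesis
      using subalgebra_history[of "N + k"] by (simp add: A_def subalgebra_def)
  qed
  have "AE w in M. \<exists>k. w \<notin> A k"
  proof (rule AE_exit_of_drift[where V = "\<lambda>k w. (norm (x (N + k) w - z))\<^sup>2"])
    show "A k \<in> sets M" for k
      using A_hist subalgebra_history by (auto simp: subalgebra_def)
    show "decseq A"
      unfolding decseq_Suc_iff by (auto simp: A_def)
    show "2 * s * rate / m * d powr (1 / p) - s\<^sup>2 > 0"
      by (rule drift_pos)
    show "integrable M (\<lambda>w. (norm (x (N + k) w - z))\<^sup>2)" for k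
      by (rule integrable_sq_dist)
    show "(\<integral>w. indicator (A k) w * (norm (x (N + Suc k) w - z))\<^sup>2 \<partial>M)
        \<le> (\<integral>w. indicator (A k) w * (norm (x (N + k) w - z))\<^sup>2 \<partial>M)
          - (2 * s * rate / m * d powr (1 / p) - s\<^sup>2) * measure M (A k)" for k
      using expected_sq_dist_step[OF A_hist[of k], of d] d_pos v by (simp add: A_def)
  qed simp
  then show ?thesis
    using AE_space
  proof eventually_elim
    fix w assume "\<exists>k. w \<notin> A k" and "w \<in> space M"
    then obtain k j where "j \<in> {N..N + k}" "\<not> total_objective m f (x j w) > ?c"
      by (auto simp: A_def)
    then show "\<exists>k\<ge>N. total_objective m f (x k w) \<le> ?c"
      by (auto simp: not_less)
  qed
qed

lemma AE_liminf_le: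
  assumes v: "\<And>k. v k = s"
  shows "AE w in M. liminf (\<lambda>k. ereal (total_objective m f (x k w)))
           \<le> ereal (total_objective m f z + (real m * s / (2 * rate)) powr p)"
proof -
  define b where "b = (real m * s / (2 * rate)) powr p"
  have "AE w in M. \<forall>n N. \<exists>k\<ge>N. total_objective m f (x k w)
          \<le> total_objective m f z + (b + 1 / real (Suc n))"
    unfolding AE_all_countable using AE_returns_below[OF v] by (auto simp: b_def)
  then show ?thesis
  proof eventually_elim
    fix w
    assume returns: "\<forall>n N. \<exists>k\<ge>N. total_objective m f (x k w)
          \<le> total_objective m f z + (b + 1 / real (Suc n))"
    show "liminf (\<lambda>k. ereal (total_objective m f (x k w)))
        \<le> ereal (total_objective m f z + (real m * s / (2 * rate)) powr p)"
    proof (rule ccontr)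
      assume "\<not> ?thesis"
      then have "ereal (total_objective m f z + b) < liminf (\<lambda>k. ereal (total_objective m f (x k w)))"
        by (simp add: b_def not_le)
      then obtain c where c: "ereal (total_objective m f z + b) < ereal c"
          "ereal c < liminf (\<lambda>k. ereal (total_objective m f (x k w)))"
        using ereal_dense2 by blast
      obtain N where N: "\<And>k. k \<ge> N \<Longrightarrow> c < total_objective m f (x k w)"
        using less_LiminfD[OF c(2)] by (auto simp: eventually_sequentially)
      obtain n where "1 / real (Suc n) < c - (total_objective m f z + b)"
        using c(1) nat_approx_posE[of "c - (total_objective m f z + b)"] by auto
      moreover obtain k where "k \<ge> N" "total_objective m f (x k w)
          \<le> total_objective m f z + (b + 1 / real (Suc n))"
        using returns by blast
      ultimately show False
        using N[of k] by linarith
    qed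
  qed
qed

end

theorem theorem3p6:
  fixes M :: "'w measure"
    and X :: "(real ^ 'n) set"
    and m :: nat
    and f :: "nat \<Rightarrow> real ^ 'n \<Rightarrow> real"
    and L :: "nat \<Rightarrow> real"
    and p v Lmax R :: real
    and x0 :: "real ^ 'n"
    and x :: "nat \<Rightarrow> 'w \<Rightarrow> real ^ 'n"
    and \<omega> :: "nat \<Rightarrow> 'w \<Rightarrow> nat"
    and g :: "nat \<Rightarrow> 'w \<Rightarrow> real ^ 'n"
  assumes X: "X \<noteq> {}" "closed X" "convex X"
    and m: "m \<ge> 1"
    and f_cont: "\<And>i. i \<in> {1..m} \<Longrightarrow> continuous_on UNIV (f i)"
    and f_qc: "\<And>i. i \<in> {1..m} \<Longrightarrow> quasi_convex (f i)"
    and common_optimum: "(\<Inter>i\<in>{1..m}. minimizers (f i) X) \<noteq> {}"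
    and p_pos: "p > 0"
    and L_pos: "\<And>i. i \<in> {1..m} \<Longrightarrow> L i > 0"
    and hoelder: "\<And>i x y. i \<in> {1..m} \<Longrightarrow> x \<in> X \<Longrightarrow>
          \<bar>f i y - f i x\<bar> \<le> L i * norm (y - x) powr p"
    and v_pos: "v > 0"
    and method_run: "randomized_incremental_subgradient M X m f (\<lambda>k. v) x0 x \<omega> g"
    and Lmax_def: "Lmax = Max (L ` {1..m})"
    and R_def: "R = Lmax powr (- 1 / p) * min 1 (real m powr (1 - 1 / p))"
  shows "AE w in M. liminf (\<lambda>k. ereal (total_objective m f (x k w)))
           \<le> ereal (min_value (total_objective m f) X + (real m * v / (2 * R)) powr p)"
proof -
  obtain z where z: "z \<in> (\<Inter>i\<in>{1..m}. minimizers (f i) X)"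
    using common_optimum by blast
  have "z \<in> X"
    using z m by (auto simp: minimizers_def is_arg_min_linorder)
  have L_le: "L i \<le> Lmax" if "i \<in> {1..m}" for i
    unfolding Lmax_def using that by (intro Max_ge) auto
  have "f i y - f i z \<le> Lmax * norm (y - z) powr p" if i: "i \<in> {1..m}" for i y
  proof -
    have "f i y - f i z \<le> L i * norm (y - z) powr p"
      using hoelder[OF i \<open>z \<in> X\<close>, of y] by linarith
    also have "\<dots> \<le> Lmax * norm (y - z) powr p"
      using L_le[OF i] by (intro mult_right_mono) auto
    finally show ?thesis .
  qed
  moreover have "Lmax > 0"
    using L_pos[of 1] L_le[of 1] m by force
  moreover have "f i \<in> borel_measurable borel" if "i \<in> {1..m}" for i
    using f_cont[OF that] by (rule borel_measurable_continuous_onI)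
  ultimately interpret run: hoelder_incremental_subgradient M X m f "\<lambda>k. v" x0 x \<omega> g z Lmax p
    using method_run X m z p_pos v_pos
    by (intro hoelder_incremental_subgradient.intro hoelder_incremental_subgradient_axioms.intro) auto
  have "R = run.rate"
    by (simp add: R_def run.rate_def)
  then show ?thesis
    using run.AE_liminf_le[OF refl] by (simp add: run.min_value_total)
qed

end
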